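(* Let $G$ be a finite group, let $A$ be the Cayley table of $G$, and for a complete mapping $f$ of $G$ let $\tilde f$, $B_f$ and $C_f$ be as defined in the context. Then the FHW parity types are as follows (the statements on $B_f$ and $C_f$ holding for every complete mapping $f$ of $G$): (a) if $|G|\equiv0\pmod 4$, then $\pi_{\mathrm{FHW}}(A)=\pi_{\mathrm{FHW}}(B_f)=\pi_{\mathrm{FHW}}(C_f)=(0,0,0)$; (b) if $|G|=1$, then $\pi_{\mathrm{FHW}}(A)=\pi_{\mathrm{FHW}}(B_f)=\pi_{\mathrm{FHW}}(C_f)=(0,0,0)$; (c) if $|G|\geq5$ and $|G|\equiv1\pmod 4$, then $\pi_{\mathrm{FHW}}(A)=(0,0,0)$, $\pi_{\mathrm{FHW}}(B_f)=(0,\pi(\tilde f),\pi(\tilde f))$ and $\pi_{\mathrm{FHW}}(C_f)=(0,\pi(f),\pi(f))$; (d) if $|G|\equiv2\pmod 4$, then $\pi_{\mathrm{FHW}}(A)=(1,1,1)$ (and $G$ has no complete mappings); (e) if $|G|=3$, then $\pi_{\mathrm{FHW}}(A)=(0,0,1)$, $\pi_{\mathrm{FHW}}(B_f)=(0,1,0)$ and $\pi_{\mathrm{FHW}}(C_f)=(0,0,1)$; (f) if $|G|\geq7$ and $|G|\equiv3\pmod 4$, then $\pi_{\mathrm{FHW}}(A)=(0,0,1)$, $\pi_{\mathrm{FHW}}(B_f)=(0,\pi(\tilde f),\pi(\tilde f)+1)$ and $\pi_{\mathrm{FHW}}(C_f)=(0,\pi(f),\pi(f)+1)$.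
   Context: For a finite set $X$, $\pi:\mathrm{Sym}(X)\to\mathbb{F}_2$ denotes parity: $\pi(f)=0$ if $f$ is even and $\pi(f)=1$ if $f$ is odd. A complete mapping of a group $G$ is a permutation $f$ of the set $G$ such that $\tilde f:G\to G$, $g\mapsto gf(g)$, is also a permutation of $G$. A Latin square over $X=\{x_1,\ldots,x_n\}$ ($|X|=n$, with this fixed ordering) is a matrix $L=(\ell_{i,j})_{1\leq i,j\leq n}$ with entries in $X$ such that each element of $X$ occurs exactly once in each row and in each column. Its $i$-th row permutation is the permutation $P_i\in\mathrm{Sym}(X)$ with $P_i(x_j)=\ell_{i,j}$ for all $j$; its $j$-th column permutation is $Q_j\in\mathrm{Sym}(X)$ with $Q_j(x_i)=\ell_{i,j}$ for all $i$; for $x\in X$, its $x$-symbol permutation is $R_x\in\mathrm{Sym}(X)$ such that $R_x(x_i)=x_j$ if and only if $\ell_{i,j}=x$. The row parity $\pi_r(L)$, column parity $\pi_c(L)$ and symbol parity $\pi_s(L)$ are the sums in $\mathbb{F}_2$ of the parities of all row permutations, of all column permutations, and of all symbol permutations (over all $x\in X$), respectively. The FHW parity type of $L$ is $\pi_{\mathrm{FHW}}(L)=(\pi_r(L),\pi_c(L),\pi_s(L))\in\mathbb{F}_2^3$. For a finite group $G=\{g_1,\ldots,g_n\}$ of order $n$ and a complete mapping $f$ of $G$, the following are Latin squares over $G$: the Cayley table $A=(g_ig_j)_{1\leq i,j\leq n}$, $B_f=(\tilde f(g_i)g_j)_{1\leq i,j\leq n}=(g_if(g_i)g_j)_{1\leq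 i,j\leq n}$, and $C_f=(f(g_i)g_j)_{1\leq i,j\leq n}$. *)

theory Defs
  imports
    "HOL-Algebra.Coset"
    "HOL-Combinatorics.Permutations"
    "HOL-Library.Z2"
    "HOL-Number_Theory.Cong"
begin

text \<open>
  The group \<open>Sym(X)\<close> is represented by the functions \<open>p\<close> with \<open>p permutes X\<close>,
  that is, the bijections of the whole type that are the identity outside \<open>X\<close>.
  The field with two elements is the type \<^typ>\<open>bit\<close>.
\<close>

definition perm_parity :: "('a \<Rightarrow> 'a) \<Rightarrow> bit"
  where "perm_parity p = (if evenperm p then 0 else 1)"

definition enumerates :: "(nat \<Rightarrow> 'a) \<Rightarrow> 'a set \<Rightarrow> bool"
  where "enumerates x X \<longleftrightarrow> finite X \<and> bij_betw x {1..card X} X"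

text \<open>
  A square matrix over \<open>X\<close> is a function \<open>L\<close> of two indices, of which only the values at
  indices in \<open>{1..card X}\<close> matter.
\<close>

definition latin_square :: "'a set \<Rightarrow> (nat \<Rightarrow> nat \<Rightarrow> 'a) \<Rightarrow> bool"
  where "latin_square X L \<longleftrightarrow>
    (\<forall>i\<in>{1..card X}. \<forall>j\<in>{1..card X}. L i j \<in> X) \<and>
    (\<forall>i\<in>{1..card X}. \<forall>s\<in>X. \<exists>!j. j \<in> {1..card X} \<and> L i j = s) \<and>
    (\<forall>j\<in>{1..card X}. \<forall>s\<in>X. \<exists>!i. i \<in> {1..card X} \<and> L i j = s)"

text \<open>
  The descriptions below are justified, for Latin squares, by the existence and uniqueness
  lemmas \<open>row_perm_ex1\<close>, \<open>col_perm_ex1\<close> and \<open>symbol_perm_ex1\<close>.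
\<close>

definition row_perm :: "'a set \<Rightarrow> (nat \<Rightarrow> 'a) \<Rightarrow> (nat \<Rightarrow> nat \<Rightarrow> 'a) \<Rightarrow> nat \<Rightarrow> 'a \<Rightarrow> 'a"
  where "row_perm X x L i =
    (THE P. P permutes X \<and> (\<forall>j\<in>{1..card X}. P (x j) = L i j))"

definition col_perm :: "'a set \<Rightarrow> (nat \<Rightarrow> 'a) \<Rightarrow> (nat \<Rightarrow> nat \<Rightarrow> 'a) \<Rightarrow> nat \<Rightarrow> 'a \<Rightarrow> 'a"
  where "col_perm X x L j =
    (THE Q. Q permutes X \<and> (\<forall>i\<in>{1..card X}. Q (x i) = L i j))"

definition symbol_perm :: "'a set \<Rightarrow> (nat \<Rightarrow> 'a) \<Rightarrow> (nat \<Rightarrow> nat \<Rightarrow> 'a) \<Rightarrow> 'a \<Rightarrow> 'a \<Rightarrow> 'a"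
  where "symbol_perm X x L s =
    (THE R. R permutes X \<and>
      (\<forall>i\<in>{1..card X}. \<forall>j\<in>{1..card X}. R (x i) = x j \<longleftrightarrow> L i j = s))"

definition row_parity :: "'a set \<Rightarrow> (nat \<Rightarrow> 'a) \<Rightarrow> (nat \<Rightarrow> nat \<Rightarrow> 'a) \<Rightarrow> bit"
  where "row_parity X x L = (\<Sum>i\<in>{1..card X}. perm_parity (row_perm X x L i))"

definition col_parity :: "'a set \<Rightarrow> (nat \<Rightarrow> 'a) \<Rightarrow> (nat \<Rightarrow> nat \<Rightarrow> 'a) \<Rightarrow> bit"
  where "col_parity X x L = (\<Sum>j\<in>{1..card X}. perm_parity (col_perm X x L j))"

definition symbol_parity :: "'a set \<Rightarrow> (nat \<Rightarrow> 'a) \<Rightarrow> (nat \<Rightarrow> nat \<Rightarrow> 'a) \<Rightarrow> bit"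
  where "symbol_parity X x L = (\<Sum>s\<in>X. perm_parity (symbol_perm X x L s))"

definition fhw_parity_type ::
    "'a set \<Rightarrow> (nat \<Rightarrow> 'a) \<Rightarrow> (nat \<Rightarrow> nat \<Rightarrow> 'a) \<Rightarrow> bit \<times> bit \<times> bit"
  where "fhw_parity_type X x L =
    (row_parity X x L, col_parity X x L, symbol_parity X x L)"

text \<open>Outside the carrier, \<open>tilde G f\<close> is the identity, as \<open>permutes\<close> requires.\<close>

definition tilde :: "('a, 'b) monoid_scheme \<Rightarrow> ('a \<Rightarrow> 'a) \<Rightarrow> 'a \<Rightarrow> 'a"
  where "tilde G f = (\<lambda>a. if a \<in> carrier G then a \<otimes>\<^bsub>G\<^esub> f a else a)"

definition complete_mapping :: "('a, 'b) monoid_scheme \<Rightarrow> ('a \<Rightarrow> 'a) \<Rightarrow> bool"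
  where "complete_mapping G f \<longleftrightarrow> f permutes carrier G \<and> tilde G f permutes carrier G"

definition cayley_table ::
    "('a, 'b) monoid_scheme \<Rightarrow> (nat \<Rightarrow> 'a) \<Rightarrow> nat \<Rightarrow> nat \<Rightarrow> 'a"
  where "cayley_table G g i j = g i \<otimes>\<^bsub>G\<^esub> g j"

definition square_B ::
    "('a, 'b) monoid_scheme \<Rightarrow> (nat \<Rightarrow> 'a) \<Rightarrow> ('a \<Rightarrow> 'a) \<Rightarrow> nat \<Rightarrow> nat \<Rightarrow> 'a"
  where "square_B G g f i j = tilde G f (g i) \<otimes>\<^bsub>G\<^esub> g j"

definition square_C ::
    "('a, 'b) monoid_scheme \<Rightarrow> (nat \<Rightarrow> 'a) \<Rightarrow> ('a \<Rightarrow> 'a) \<Rightarrow> nat \<Rightarrow> nat \<Rightarrow> 'a"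
  where "square_C G g f i j = f (g i) \<otimes>\<^bsub>G\<^esub> g j"

lemma bij_betw_ex1:
  assumes "bij_betw h I X" and "a \<in> X"
  shows "\<exists>!i. i \<in> I \<and> h i = a"
  using assms unfolding bij_betw_def inj_on_def by blast

lemma enumerated_perm_ex1:
  assumes x: "bij_betw x I X" and h: "bij_betw h I X"
  shows "\<exists>!P. P permutes X \<and> (\<forall>j\<in>I. P (x j) = h j)"
proof -
  define P where "P = (\<lambda>y. if y \<in> X then h (inv_into I x y) else y)"
  have "bij_betw (h \<circ> inv_into I x) X X"
    using bij_betw_inv_into[OF x] h by (rule bij_betw_trans)
  then have "bij_betw P X X"
    by (rule bij_betw_cong[THEN iffD1, rotated]) (simp add: P_def)
  then have "P permutes X"
    by (rule bij_imp_permutes) (simp add: P_def)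
  moreover have "P (x j) = h j" if "j \<in> I" for j
    using that x by (simp add: P_def bij_betw_inv_into_left bij_betw_apply)
  moreover have "Q = P" if Q: "Q permutes X" "\<forall>j\<in>I. Q (x j) = h j" for Q
  proof
    fix y
    show "Q y = P y"
    proof (cases "y \<in> X")
      case True
      then obtain j where "j \<in> I" "y = x j" using x by (auto simp: bij_betw_def)
      with Q \<open>\<And>j. j \<in> I \<Longrightarrow> P (x j) = h j\<close> show ?thesis by simp
    next
      case False
      with Q show ?thesis by (simp add: P_def permutes_not_in)
    qed
  qed
  ultimately show ?thesis by blast
qed

lemma row_perm_ex1:
  assumes x: "enumerates x X" and L: "latin_square X L" and i: "i \<in> {1..card X}"
  shows "\<exists>!P. P permutes X \<and> (\<forall>j\<in>{1..card X}. P (x j) = L i j)"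
proof (rule enumerated_perm_ex1)
  show "bij_betw x {1..card X} X" using x by (simp add: enumerates_def)
  have mem: "\<forall>j\<in>{1..card X}. L i j \<in> X" and ex1: "\<forall>s\<in>X. \<exists>!j. j \<in> {1..card X} \<and> L i j = s"
    using L i unfolding latin_square_def by blast+
  show "bij_betw (L i) {1..card X} X"
    unfolding bij_betw_def
  proof
    show "inj_on (L i) {1..card X}" using mem ex1 unfolding inj_on_def by blast
    show "L i ` {1..card X} = X" using mem ex1 by blast
  qed
qed

lemma col_perm_ex1:
  assumes x: "enumerates x X" and L: "latin_square X L" and j: "j \<in> {1..card X}"
  shows "\<exists>!Q. Q permutes X \<and> (\<forall>i\<in>{1..card X}. Q (x i) = L i j)"
proof (rule enumerated_perm_ex1)
  show "bij_betw x {1..card X} X" using x by (simp add: enumerates_def)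
  have mem: "\<forall>i\<in>{1..card X}. L i j \<in> X" and ex1: "\<forall>s\<in>X. \<exists>!i. i \<in> {1..card X} \<and> L i j = s"
    using L j unfolding latin_square_def by blast+
  show "bij_betw (\<lambda>i. L i j) {1..card X} X"
    unfolding bij_betw_def
  proof
    show "inj_on (\<lambda>i. L i j) {1..card X}" using mem ex1 unfolding inj_on_def by blast
    show "(\<lambda>i. L i j) ` {1..card X} = X" using mem ex1 by blast
  qed
qed

lemma symbol_perm_ex1:
  assumes x: "enumerates x X" and L: "latin_square X L" and s: "s \<in> X"
  shows "\<exists>!R. R permutes X \<and>
    (\<forall>i\<in>{1..card X}. \<forall>j\<in>{1..card X}. R (x i) = x j \<longleftrightarrow> L i j = s)"
proof -
  let ?I = "{1..card X}"
  have bx: "bij_betw x ?I X" using x by (simp add: enumerates_def)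
  have row: "\<forall>i\<in>?I. \<exists>!j. j \<in> ?I \<and> L i j = s" and col: "\<forall>j\<in>?I. \<exists>!i. i \<in> ?I \<and> L i j = s"
    using L s unfolding latin_square_def by blast+
  from row obtain k where k: "\<And>i. i \<in> ?I \<Longrightarrow> k i \<in> ?I \<and> L i (k i) = s" by metis
  have k_iff: "k i = j \<longleftrightarrow> L i j = s" if "i \<in> ?I" "j \<in> ?I" for i j
    using k row that by metis
  have "bij_betw k ?I ?I"
    unfolding bij_betw_def
  proof
    show "inj_on k ?I" using k col unfolding inj_on_def by (metis (no_types, lifting))
    show "k ` ?I = ?I"
    proof
      show "k ` ?I \<subseteq> ?I" using k by blast
      show "?I \<subseteq> k ` ?I"
      proof
        fix j assume j: "j \<in> ?I"
        then obtain i where "i \<in> ?I" "L i j = s" using col by blast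
        with j k_iff show "j \<in> k ` ?I" by blast
      qed
    qed
  qed
  then have bk: "bij_betw (x \<circ> k) ?I X" using bx by (rule bij_betw_trans)
  have "(\<forall>i\<in>?I. \<forall>j\<in>?I. R (x i) = x j \<longleftrightarrow> L i j = s) \<longleftrightarrow> (\<forall>i\<in>?I. R (x i) = (x \<circ> k) i)"
    (is "?lhs \<longleftrightarrow> ?rhs") for R
  proof
    assume ?lhs
    with k show ?rhs by (metis comp_apply)
  next
    assume ?rhs
    moreover have "x (k i) = x j \<longleftrightarrow> k i = j" if "i \<in> ?I" "j \<in> ?I" for i j
      using that k bx by (metis bij_betw_def inj_on_eq_iff)
    ultimately show ?lhs using k_iff by simp
  qed
  then show ?thesis using enumerated_perm_ex1[OF bx bk] by simp
qed

lemma latin_square_left_perm: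
  assumes G: "group G" and g: "enumerates g (carrier G)" and p: "p permutes carrier G"
  shows "latin_square (carrier G) (\<lambda>i j. p (g i) \<otimes>\<^bsub>G\<^esub> g j)"
proof -
  interpret group G by (rule G)
  let ?I = "{1..card (carrier G)}"
  have bg: "bij_betw g ?I (carrier G)" using g by (simp add: enumerates_def)
  have bpg: "bij_betw (p \<circ> g) ?I (carrier G)"
    using bg permutes_imp_bij[OF p] by (rule bij_betw_trans)
  have gI: "g i \<in> carrier G" if "i \<in> ?I" for i using bg that by (rule bij_betw_apply)
  have pI: "p (g i) \<in> carrier G" if "i \<in> ?I" for i using bij_betw_apply[OF bpg that] by simp
  have g1: "\<exists>!j. j \<in> ?I \<and> g j = a" if "a \<in> carrier G" for a
    using bg that by (rule bij_betw_ex1)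
  have p1: "\<exists>!i. i \<in> ?I \<and> p (g i) = a" if "a \<in> carrier G" for a
    using bij_betw_ex1[OF bpg that] by simp
  have row: "\<exists>!j. j \<in> ?I \<and> p (g i) \<otimes>\<^bsub>G\<^esub> g j = s" if "i \<in> ?I" "s \<in> carrier G" for i s
  proof -
    have "p (g i) \<otimes>\<^bsub>G\<^esub> g j = s \<longleftrightarrow> g j = inv\<^bsub>G\<^esub> (p (g i)) \<otimes>\<^bsub>G\<^esub> s" if "j \<in> ?I" for j
      using inv_solve_left[of "g j" "p (g i)" s] gI[OF that] pI[OF \<open>i \<in> ?I\<close>] \<open>s \<in> carrier G\<close>
      by auto
    moreover have "\<exists>!j. j \<in> ?I \<and> g j = inv\<^bsub>G\<^esub> (p (g i)) \<otimes>\<^bsub>G\<^esub> s"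
      using pI[OF \<open>i \<in> ?I\<close>] \<open>s \<in> carrier G\<close> by (intro g1) simp
    ultimately show ?thesis
      by (simp cong: conj_cong del: atLeastAtMost_iff)
  qed
  have col: "\<exists>!i. i \<in> ?I \<and> p (g i) \<otimes>\<^bsub>G\<^esub> g j = s" if "j \<in> ?I" "s \<in> carrier G" for j s
  proof -
    have "p (g i) \<otimes>\<^bsub>G\<^esub> g j = s \<longleftrightarrow> p (g i) = s \<otimes>\<^bsub>G\<^esub> inv\<^bsub>G\<^esub> (g j)" if "i \<in> ?I" for i
      using inv_solve_right[of "p (g i)" s "g j"] pI[OF that] gI[OF \<open>j \<in> ?I\<close>] \<open>s \<in> carrier G\<close>
      by auto
    moreover have "\<exists>!i. i \<in> ?I \<and> p (g i) = s \<otimes>\<^bsub>G\<^esub> inv\<^bsub>G\<^esub> (g j)"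
      using gI[OF \<open>j \<in> ?I\<close>] \<open>s \<in> carrier G\<close> by (intro p1) simp
    ultimately show ?thesis
      by (simp cong: conj_cong del: atLeastAtMost_iff)
  qed
  show ?thesis
    unfolding latin_square_def using row col gI pI by simp
qed

lemma latin_square_cayley_table:
  assumes "group G" "enumerates g (carrier G)"
  shows "latin_square (carrier G) (cayley_table G g)"
  using latin_square_left_perm[OF assms permutes_id] by (simp add: cayley_table_def[abs_def])

lemma latin_square_square_B:
  assumes "group G" "enumerates g (carrier G)" "complete_mapping G f"
  shows "latin_square (carrier G) (square_B G g f)"
  using latin_square_left_perm[of G g "tilde G f"] assms
  by (simp add: square_B_def[abs_def] complete_mapping_def)

lemma latin_square_square_C:
  assumes "group G" "enumerates g (carrier G)" "complete_mapping G f"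
  shows "latin_square (carrier G) (square_C G g f)"
  using latin_square_left_perm[of G g f] assms
  by (simp add: square_C_def[abs_def] complete_mapping_def)

end

theory Submission
  imports Defs
begin

text \<open>
  All squares in question have the form \<open>L i j = p (g i) \<otimes> g j\<close> for a permutation \<open>p\<close> of the
  group: \<open>p\<close> is the identity for \<open>A\<close>, is \<open>tilde G f\<close> for \<open>B\<close> and is \<open>f\<close> for \<open>C\<close>. Their row
  permutations are the left translations, each occurring once. The column permutations are the
  maps \<open>\<rho> \<circ> p\<close>, and the symbol permutations are the maps \<open>\<rho> \<circ> inv \<circ> p\<close>, where \<open>\<rho>\<close> runs
  through the right translations. Inversion conjugates a right translation to a left one, so if
  \<open>\<phi> a\<close> is the parity of the left translation by \<open>a\<close>, if \<open>\<sigma>\<close> is the sum of \<open>\<phi>\<close> over the group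
  and if \<open>n\<close> is the group order, then the parity type is
  \<open>(\<sigma>, \<sigma> + n \<cdot> \<pi>(p), \<sigma> + n \<cdot> (\<pi>(inv) + \<pi>(p)))\<close>. This is \<open>fhw_parity_type_left_perm\<close>.

  It remains to find \<open>\<sigma>\<close> for every \<open>n\<close>, and \<open>\<pi>(inv)\<close> for odd \<open>n\<close>. The map \<open>\<phi>\<close> is a homomorphism
  to the field with two elements. If it is not zero, its fibres both have \<open>n / 2\<close> elements, so
  \<open>n\<close> is even and \<open>\<sigma>\<close> is the parity of \<open>n / 2\<close>. Hence \<open>\<sigma> = 0\<close> unless \<open>n \<equiv> 2 (mod 4)\<close>. In that
  case there is an involution \<open>c\<close>, the translation by \<open>c\<close> is a product of the odd number \<open>n / 2\<close>
  of transpositions, so \<open>\<phi> \<noteq> 0\<close> and \<open>\<sigma> = 1\<close>. Here a complete mapping \<open>f\<close> cannot exist: summing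
  \<open>\<phi> (x \<otimes> f x) = \<phi> x + \<phi> (f x)\<close> over the group gives \<open>\<sigma> = \<sigma> + \<sigma> = 0\<close>. When \<open>n\<close> is odd, inversion
  fixes only the neutral element, so it is a product of \<open>(n - 1) / 2\<close> transpositions.

  For \<open>n = 3\<close> the parities of \<open>f\<close> and \<open>tilde G f\<close> are forced as well. If \<open>f\<close> were a
  transposition of \<open>y\<close> and \<open>z\<close>, then \<open>tilde G f\<close> would take the same value \<open>y \<otimes> z = z \<otimes> y\<close> at both,
  so \<open>f\<close> is even. And \<open>tilde G f\<close> fixes the point that \<open>f\<close> sends to \<open>\<one>\<close>, but is not the identity,
  so it is a transposition.
\<close>

section \<open>Parity of permutations\<close>

lemma perm_parity_id [simp]: "perm_parity id = 0"
  by (simp add: perm_parity_def)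

lemma perm_parity_comp:
  assumes "finite X" "p permutes X" "q permutes X"
  shows "perm_parity (p \<circ> q) = perm_parity p + perm_parity q"
  using assms evenperm_comp[of p q] permutes_imp_permutation[of X]
  by (auto simp: perm_parity_def)

text \<open>
  An involution is a product of disjoint transpositions, one for each two points that it moves.
  Peeling off one of these transpositions gives the induction.
\<close>

lemma perm_parity_involution:
  assumes "finite X" "p permutes X" "p \<circ> p = id"
  obtains k where "card {x \<in> X. p x \<noteq> x} = 2 * k" "perm_parity p = of_nat k"
proof -
  have "\<exists>k. card {x \<in> X. p x \<noteq> x} = 2 * k \<and> perm_parity p = of_nat k"
    using assms
  proof (induction "card {x \<in> X. p x \<noteq> x}" arbitrary: p rule: less_induct)
    case less
    have pp: "p (p x) = x" for x
      using less.prems(3) by (simp add: fun_eq_iff)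
    show ?case
    proof (cases "\<exists>a\<in>X. p a \<noteq> a")
      case False
      then have "p = id"
        using permutes_not_in[OF less.prems(2)] by (auto simp: fun_eq_iff)
      then show ?thesis by simp
    next
      case True
      then obtain a where a: "a \<in> X" "p a \<noteq> a" by blast
      have pa: "p a \<in> X" using a less.prems(2) by (simp add: permutes_in_image)
      \<comment> \<open>Composing with the transposition that \<open>p\<close> induces on \<open>{a, p a}\<close> removes it from \<open>p\<close>.\<close>
      define t where "t = transpose a (p a)"
      define q where "q = t \<circ> p"
      have t: "t permutes X" unfolding t_def using a pa by (simp add: permutes_swap_id)
      have q: "q permutes X"
        unfolding q_def using less.prems(2) t by (rule permutes_compose)
      have q_eq: "q x = (if x = a \<or> x = p a then x else p x)" for x
      proof -
        have "p x = a \<longleftrightarrow> x = p a" "p x = p a \<longleftrightarrow> x = a" using pp by metis+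
        then show ?thesis
          using pp by (auto simp: q_def t_def transpose_def)
      qed
      have "(q \<circ> q) x = id x" for x
      proof -
        have "p x = a \<longleftrightarrow> x = p a" "p x = p a \<longleftrightarrow> x = a" using pp by metis+
        then show ?thesis using pp by (auto simp: q_eq)
      qed
      then have qq: "q \<circ> q = id" by blast
      have moved: "{x \<in> X. p x \<noteq> x} = insert a (insert (p a) {x \<in> X. q x \<noteq> x})"
        using a pa pp by (auto simp: q_eq)
      have "a \<notin> insert (p a) {x \<in> X. q x \<noteq> x}" "p a \<notin> {x \<in> X. q x \<noteq> x}"
        using a by (auto simp: q_eq)
      then have card: "card {x \<in> X. p x \<noteq> x} = Suc (Suc (card {x \<in> X. q x \<noteq> x}))"
        using less.prems(1) by (simp add: moved)
      then have "card {x \<in> X. q x \<noteq> x} < card {x \<in> X. p x \<noteq> x}" by simp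
      from less.hyps[OF this less.prems(1) q qq] obtain k
        where k: "card {x \<in> X. q x \<noteq> x} = 2 * k" "perm_parity q = of_nat k" by blast
      have "perm_parity t = 1"
        using a by (simp add: t_def perm_parity_def evenperm_swap)
      then have "perm_parity q = 1 + perm_parity p"
        unfolding q_def using perm_parity_comp[OF less.prems(1) t less.prems(2)] by simp
      then have "perm_parity p = of_nat (Suc k)"
        using k by (cases "perm_parity p") (auto split: if_splits)
      with card k show ?thesis by (intro exI[of _ "Suc k"]) simp
    qed
  qed
  with that show ?thesis by blast
qed

lemma permutes_three_fixed_point:
  assumes p: "p permutes {x, y, z}" and fixed: "p x = x" and distinct: "x \<noteq> y" "x \<noteq> z" "y \<noteq> z"
  shows "p = id \<or> p = transpose y z"
proof -
  have "p y \<in> {x, y, z}" "p z \<in> {x, y, z}"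
    using p by (simp_all add: permutes_in_image del: insert_iff) auto
  moreover have "p y \<noteq> p x" "p z \<noteq> p x" "p y \<noteq> p z"
    using distinct permutes_inj[OF p] by (auto dest: injD)
  ultimately have "p y = y \<and> p z = z \<or> p y = z \<and> p z = y"
    using fixed by auto
  then show ?thesis
    using fixed permutes_not_in[OF p] by (fastforce simp: fun_eq_iff transpose_def)
qed

text \<open>
  Such a permutation is a 3-cycle, because exchanging two points would fix the third one. Its cube
  is the identity, and the parity of the cube is three times, hence once, its own parity.
\<close>

lemma perm_parity_three_no_fixed_point:
  assumes X: "card X = 3" and p: "p permutes X" and no_fixed: "\<And>x. x \<in> X \<Longrightarrow> p x \<noteq> x"
  shows "perm_parity p = 0"
proof -
  have fin: "finite X" using X card.infinite by fastforce
  have inj: "p u = p v \<longleftrightarrow> u = v" for u v using permutes_inj[OF p] by (auto dest: injD)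
  have "p (p (p x)) = x" for x
  proof (cases "x \<in> X")
    case True
    then have mem: "p x \<in> X" "p (p x) \<in> X" "p (p (p x)) \<in> X"
      using p by (simp_all add: permutes_in_image)
    have no_swap: "p (p x) \<noteq> x"
    proof
      assume swap: "p (p x) = x"
      have "card {x, p x} = 2" using no_fixed[OF True] by auto
      then have "card (X - {x, p x}) = 1"
        using X fin True mem by (simp add: card_Diff_subset)
      then obtain z where z: "X - {x, p x} = {z}" by (auto simp: card_1_singleton_iff)
      then have "z \<in> X" "z \<noteq> x" "z \<noteq> p x" by auto
      moreover from this have "p z \<in> X" "p z \<noteq> p x" "p z \<noteq> p (p x)"
        using p inj by (auto simp: permutes_in_image)
      ultimately show False using z swap no_fixed by auto
    qed
    then have "card {x, p x, p (p x)} = 3"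
      using no_fixed[OF True] no_fixed[OF mem(1)] by auto
    then have "{x, p x, p (p x)} = X"
      using X True mem by (intro card_subset_eq[OF fin]) auto
    then have "p (p (p x)) \<in> {x, p x, p (p x)}" using mem(3) by simp
    moreover have "p (p (p x)) \<noteq> p x" using no_swap by (simp only: inj not_False_eq_True)
    moreover have "p (p (p x)) \<noteq> p (p x)" using no_fixed[OF mem(2)] .
    ultimately show ?thesis by simp
  qed (simp add: permutes_not_in[OF p])
  then have "p \<circ> (p \<circ> p) = id" by (simp add: fun_eq_iff)
  then have "perm_parity p + (perm_parity p + perm_parity p) = 0"
    using perm_parity_comp[OF fin p permutes_compose[OF p p]] perm_parity_comp[OF fin p p]
    by simp
  then show ?thesis by simp
qed

section \<open>Translations and inversion\<close>

text \<open>This turns a bijection of \<open>X\<close> to itself into a function that \<open>permutes\<close> \<open>X\<close>.\<close>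

definition extend_by_id :: "'a set \<Rightarrow> ('a \<Rightarrow> 'a) \<Rightarrow> 'a \<Rightarrow> 'a"
  where "extend_by_id X h = (\<lambda>x. if x \<in> X then h x else x)"

lemma extend_by_id_permutes:
  assumes "bij_betw h X X"
  shows "extend_by_id X h permutes X"
proof (rule bij_imp_permutes)
  show "bij_betw (extend_by_id X h) X X"
    using assms by (rule bij_betw_cong[THEN iffD1, rotated]) (simp add: extend_by_id_def)
qed (simp add: extend_by_id_def)

definition left_translation :: "('a, 'b) monoid_scheme \<Rightarrow> 'a \<Rightarrow> 'a \<Rightarrow> 'a"
  where "left_translation G a = extend_by_id (carrier G) (\<lambda>x. a \<otimes>\<^bsub>G\<^esub> x)"

definition right_translation :: "('a, 'b) monoid_scheme \<Rightarrow> 'a \<Rightarrow> 'a \<Rightarrow> 'a"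
  where "right_translation G a = extend_by_id (carrier G) (\<lambda>x. x \<otimes>\<^bsub>G\<^esub> a)"

definition inversion :: "('a, 'b) monoid_scheme \<Rightarrow> 'a \<Rightarrow> 'a"
  where "inversion G = extend_by_id (carrier G) (\<lambda>x. inv\<^bsub>G\<^esub> x)"

context group
begin

lemma left_translation_permutes:
  assumes "a \<in> carrier G"
  shows "left_translation G a permutes carrier G"
  unfolding left_translation_def
proof (rule extend_by_id_permutes, rule bij_betw_byWitness)
  show "\<forall>x\<in>carrier G. inv a \<otimes> (a \<otimes> x) = x" "\<forall>x\<in>carrier G. a \<otimes> (inv a \<otimes> x) = x"
    using assms by (simp_all flip: m_assoc)
qed (use assms in auto)

lemma inversion_permutes: "inversion G permutes carrier G"
  unfolding inversion_def
  by (rule extend_by_id_permutes, rule bij_betw_byWitness[where f' = "\<lambda>x. inv x"]) auto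

lemma inversion_involution: "inversion G \<circ> inversion G = id"
  by (auto simp: inversion_def extend_by_id_def)

lemma right_translation_conv_left:
  assumes "a \<in> carrier G"
  shows "right_translation G a = inversion G \<circ> (left_translation G (inv a) \<circ> inversion G)"
  using assms
  by (auto simp: fun_eq_iff inversion_def extend_by_id_def left_translation_def
      right_translation_def inv_mult_group)

lemma right_translation_permutes:
  assumes "a \<in> carrier G"
  shows "right_translation G a permutes carrier G"
  using assms
  by (simp add: right_translation_conv_left permutes_compose inversion_permutes
      left_translation_permutes)

lemma perm_parity_left_translation_mult:
  assumes "finite (carrier G)" "a \<in> carrier G" "b \<in> carrier G"
  shows "perm_parity (left_translation G (a \<otimes> b))
    = perm_parity (left_translation G a) + perm_parity (left_translation G b)"
proof -
  have "left_translation G (a \<otimes> b) = left_translation G a \<circ> left_translation G b"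
    using assms by (auto simp: fun_eq_iff left_translation_def extend_by_id_def m_assoc)
  then show ?thesis
    using assms by (simp add: perm_parity_comp left_translation_permutes)
qed

lemma perm_parity_left_translation_inv:
  assumes "finite (carrier G)" "a \<in> carrier G"
  shows "perm_parity (left_translation G (inv a)) = perm_parity (left_translation G a)"
proof -
  have "left_translation G \<one> = id"
    by (auto simp: fun_eq_iff left_translation_def extend_by_id_def)
  then have "perm_parity (left_translation G (inv a)) + perm_parity (left_translation G a) = 0"
    using assms perm_parity_left_translation_mult[of "inv a" a] by simp
  then show ?thesis
    by (cases "perm_parity (left_translation G a)") auto
qed

text \<open>A right translation is conjugate to the left translation by the inverse element.\<close>

lemma perm_parity_right_translation:
  assumes fin: "finite (carrier G)" and a: "a \<in> carrier G"
  shows "perm_parity (right_translation G a) = perm_parity (left_translation G a)"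
proof -
  have L: "left_translation G (inv a) permutes carrier G"
    using a by (simp add: left_translation_permutes)
  have "perm_parity (right_translation G a) = perm_parity (inversion G)
      + (perm_parity (left_translation G (inv a)) + perm_parity (inversion G))"
    unfolding right_translation_conv_left[OF a]
      perm_parity_comp[OF fin inversion_permutes permutes_compose[OF inversion_permutes L]]
      perm_parity_comp[OF fin L inversion_permutes] ..
  then show ?thesis
    using perm_parity_left_translation_inv[OF fin a]
    by (cases "perm_parity (inversion G)") auto
qed

text \<open>A translation by an element of order two is an involution without fixed points.\<close>

lemma perm_parity_translation_by_involution:
  assumes fin: "finite (carrier G)" and c: "c \<in> carrier G" "c \<noteq> \<one>" "c \<otimes> c = \<one>"
  obtains k where "order G = 2 * k" "perm_parity (left_translation G c) = of_nat k"
proof -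
  have "left_translation G c \<circ> left_translation G c = id"
    using c by (auto simp: fun_eq_iff left_translation_def extend_by_id_def simp flip: m_assoc)
  from perm_parity_involution[OF fin left_translation_permutes[OF c(1)] this] obtain k
    where k: "card {x \<in> carrier G. left_translation G c x \<noteq> x} = 2 * k"
      "perm_parity (left_translation G c) = of_nat k" by blast
  have "{x \<in> carrier G. left_translation G c x \<noteq> x} = carrier G"
    using c by (auto simp: left_translation_def extend_by_id_def)
  with k that show ?thesis by (simp add: order_def)
qed

text \<open>
  The elements that inversion moves come in pairs, so in a group of even order the number of fixed
  points of inversion is even. One of them is \<open>\<one>\<close>, so there is another.
\<close>

lemma even_order_imp_involution:
  assumes fin: "finite (carrier G)" and even: "even (order G)"
  obtains c where "c \<in> carrier G" "c \<noteq> \<one>" "c \<otimes> c = \<one>"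
proof (rule ccontr)
  assume "\<not> thesis"
  with that have "c \<otimes> c \<noteq> \<one>" if "c \<in> carrier G" "c \<noteq> \<one>" for c using that by blast
  then have "{x \<in> carrier G. inversion G x \<noteq> x} = carrier G - {\<one>}"
    by (auto simp: inversion_def extend_by_id_def) (metis r_inv)
  moreover obtain k where "card {x \<in> carrier G. inversion G x \<noteq> x} = 2 * k"
    using perm_parity_involution[OF fin inversion_permutes inversion_involution] by blast
  ultimately have "card (carrier G - {\<one>}) = 2 * k" by simp
  moreover have "Suc (card (carrier G - {\<one>})) = order G"
    using fin unfolding order_def by (intro card_Suc_Diff1) auto
  ultimately show False using even by presburger
qed

text \<open>In odd order no element has order two, so inversion moves everything except \<open>\<one>\<close>.\<close>

lemma perm_parity_inversion_odd_order:
  assumes fin: "finite (carrier G)" and odd: "odd (order G)"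
  shows "perm_parity (inversion G) = of_nat (order G div 2)"
proof -
  have "c \<otimes> c \<noteq> \<one>" if "c \<in> carrier G" "c \<noteq> \<one>" for c
    using perm_parity_translation_by_involution[OF fin that] odd by (metis dvd_triv_left)
  then have "{x \<in> carrier G. inversion G x \<noteq> x} = carrier G - {\<one>}"
    by (auto simp: inversion_def extend_by_id_def) (metis r_inv)
  moreover obtain k where k: "card {x \<in> carrier G. inversion G x \<noteq> x} = 2 * k"
      "perm_parity (inversion G) = of_nat k"
    using perm_parity_involution[OF fin inversion_permutes inversion_involution] by blast
  moreover have "Suc (card (carrier G - {\<one>})) = order G"
    using fin unfolding order_def by (intro card_Suc_Diff1) auto
  ultimately have "order G div 2 = k" by simp
  with k show ?thesis by simp
qed

section \<open>The sum of the parities of all translations\<close>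

text \<open>
  Multiplication by an element with value \<open>1\<close> exchanges the two fibres, so each of them contains
  half of the group.
\<close>

lemma sum_nonzero_hom_bit:
  fixes h :: "'a \<Rightarrow> bit"
  assumes fin: "finite (carrier G)"
    and hom: "\<And>a b. a \<in> carrier G \<Longrightarrow> b \<in> carrier G \<Longrightarrow> h (a \<otimes> b) = h a + h b"
    and c: "c \<in> carrier G" "h c \<noteq> 0"
  obtains k where "order G = 2 * k" "(\<Sum>a\<in>carrier G. h a) = of_nat k"
proof
  let ?K = "{a \<in> carrier G. h a = 0}" and ?N = "{a \<in> carrier G. h a = 1}"
  have hc: "h c = 1" using c(2) by simp
  have "bij_betw (\<lambda>x. c \<otimes> x) ?K ?N"
  proof (rule bij_betw_byWitness)
    show "\<forall>x\<in>?K. inv c \<otimes> (c \<otimes> x) = x" "\<forall>x\<in>?N. c \<otimes> (inv c \<otimes> x) = x"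
      using c by (simp_all flip: m_assoc)
    show "(\<lambda>x. c \<otimes> x) ` ?K \<subseteq> ?N" using c hc by (auto simp: hom)
    have "h (inv c) = 1"
      using hom[of "inv c" c] hom[of \<one> \<one>] c hc by (cases "h (inv c)") auto
    then show "(\<lambda>x. inv c \<otimes> x) ` ?N \<subseteq> ?K" using c by (auto simp: hom)
  qed
  then have "card ?K = card ?N" by (rule bij_betw_same_card)
  moreover have "carrier G = ?K \<union> ?N" by auto
  then have "card (carrier G) = card ?K + card ?N"
    using fin by (subst \<open>carrier G = _\<close>, intro card_Un_disjoint) auto
  ultimately show "order G = 2 * card ?N" by (simp add: order_def)
  have "(\<Sum>a\<in>carrier G. h a) = (\<Sum>a\<in>carrier G. if h a = 1 then 1 else 0)"
    by (intro sum.cong) auto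
  also have "\<dots> = of_nat (card ?N)"
    using fin by (simp add: sum.If_cases Int_def)
  finally show "(\<Sum>a\<in>carrier G. h a) = of_nat (card ?N)" .
qed

definition translation_parity_sum :: bit
  where "translation_parity_sum = (\<Sum>a\<in>carrier G. perm_parity (left_translation G a))"

lemma translation_parity_sum_eq_0:
  assumes fin: "finite (carrier G)" and "order G mod 4 \<noteq> 2"
  shows "translation_parity_sum = 0"
proof (cases "\<exists>c\<in>carrier G. perm_parity (left_translation G c) \<noteq> 0")
  case True
  then obtain c where "c \<in> carrier G" "perm_parity (left_translation G c) \<noteq> 0" by blast
  from sum_nonzero_hom_bit[OF fin perm_parity_left_translation_mult[OF fin] this]
  obtain k where k: "order G = 2 * k" "translation_parity_sum = of_nat k"
    unfolding translation_parity_sum_def by blast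
  with assms(2) have "even k" by presburger
  with k show ?thesis by (auto elim!: evenE)
qed (simp add: translation_parity_sum_def)

lemma translation_parity_sum_eq_1:
  assumes fin: "finite (carrier G)" and mod4: "order G mod 4 = 2"
  shows "translation_parity_sum = 1"
proof -
  have half_odd: "of_nat k = (1 :: bit)" if "order G = 2 * k" for k
  proof -
    have "odd k" using that mod4 by presburger
    then show ?thesis by (auto elim!: oddE)
  qed
  have "even (order G)" using mod4 by presburger
  then obtain c where c: "c \<in> carrier G" "c \<noteq> \<one>" "c \<otimes> c = \<one>"
    using even_order_imp_involution[OF fin] by blast
  have "perm_parity (left_translation G c) \<noteq> 0"
    using perm_parity_translation_by_involution[OF fin c] half_odd by (metis zero_neq_one)
  from sum_nonzero_hom_bit[OF fin perm_parity_left_translation_mult[OF fin] c(1) this]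
  show ?thesis
    unfolding translation_parity_sum_def using half_odd by metis
qed

text \<open>
  Summing the parity homomorphism over the values of \<open>tilde G f\<close> counts every group element
  twice, once as an argument of \<open>f\<close> and once as a value. But \<open>tilde G f\<close> takes every value once, so
  the sum of the parities would be \<open>0\<close>.
\<close>

lemma no_complete_mapping:
  assumes fin: "finite (carrier G)" and mod4: "order G mod 4 = 2"
  shows "\<not> complete_mapping G f"
proof
  assume "complete_mapping G f"
  then have f: "f permutes carrier G" and t: "tilde G f permutes carrier G"
    by (simp_all add: complete_mapping_def)
  let ?h = "\<lambda>a. perm_parity (left_translation G a)"
  have "translation_parity_sum = (\<Sum>a\<in>carrier G. ?h (tilde G f a))"
    unfolding translation_parity_sum_def by (subst sum.permute[OF t]) simp
  also have "\<dots> = (\<Sum>a\<in>carrier G. ?h a + ?h (f a))"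
    using f fin
    by (intro sum.cong)
       (simp_all add: tilde_def permutes_in_image perm_parity_left_translation_mult)
  also have "\<dots> = translation_parity_sum + (\<Sum>a\<in>carrier G. ?h (f a))"
    unfolding sum.distrib translation_parity_sum_def ..
  also have "(\<Sum>a\<in>carrier G. ?h (f a)) = translation_parity_sum"
    unfolding translation_parity_sum_def by (subst (2) sum.permute[OF f]) simp
  finally show False using translation_parity_sum_eq_1[OF fin mod4] by simp
qed

section \<open>The parity type of a Cayley table with permuted rows\<close>

lemma fhw_parity_type_left_perm:
  assumes g: "enumerates g (carrier G)" and p: "p permutes carrier G"
  shows "fhw_parity_type (carrier G) g (\<lambda>i j. p (g i) \<otimes> g j) =
    (translation_parity_sum,
     translation_parity_sum + of_nat (order G) * perm_parity p,
     translation_parity_sum + of_nat (order G) * (perm_parity (inversion G) + perm_parity p))"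
proof -
  let ?X = "carrier G" and ?L = "\<lambda>i j. p (g i) \<otimes> g j"
  let ?I = "{1..card ?X}"
  let ?h = "\<lambda>a. perm_parity (left_translation G a)"
  have fin: "finite ?X" and bij: "bij_betw g ?I ?X" using g by (simp_all add: enumerates_def)
  have L: "latin_square ?X ?L" using latin_square_left_perm[OF is_group g p] .
  have gI: "g i \<in> ?X" if "i \<in> ?I" for i using bij_betw_apply[OF bij that] .
  have pX: "p x \<in> ?X \<longleftrightarrow> x \<in> ?X" for x by (rule permutes_in_image[OF p])
  have reindex: "(\<Sum>i\<in>?I. w (g i)) = sum w ?X" for w :: "'a \<Rightarrow> bit"
    by (rule sum.reindex_bij_betw[OF bij])
  have row: "row_perm ?X g ?L i = left_translation G (p (g i))" if i: "i \<in> ?I" for i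
    unfolding row_perm_def
  proof (rule the1_equality[OF row_perm_ex1[OF g L i]], intro conjI ballI)
    show "left_translation G (p (g i)) permutes ?X"
      using gI[OF i] pX by (simp add: left_translation_permutes)
  qed (use gI in \<open>simp add: left_translation_def extend_by_id_def\<close>)
  have col: "col_perm ?X g ?L j = right_translation G (g j) \<circ> p" if j: "j \<in> ?I" for j
    unfolding col_perm_def
  proof (rule the1_equality[OF col_perm_ex1[OF g L j]], intro conjI ballI)
    show "right_translation G (g j) \<circ> p permutes ?X"
      using gI[OF j] by (intro permutes_compose p right_translation_permutes)
  qed (use gI pX in \<open>simp add: right_translation_def extend_by_id_def\<close>)
  \<comment> \<open>The symbol permutation for \<open>s\<close> solves \<open>p x \<otimes> y = s\<close> for \<open>y\<close>.\<close>
  have symbol: "symbol_perm ?X g ?L s = right_translation G s \<circ> (inversion G \<circ> p)"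
    if s: "s \<in> ?X" for s
    unfolding symbol_perm_def
  proof (rule the1_equality[OF symbol_perm_ex1[OF g L s]], intro conjI ballI)
    show "right_translation G s \<circ> (inversion G \<circ> p) permutes ?X"
      using s by (intro permutes_compose p right_translation_permutes inversion_permutes)
    fix i j assume "i \<in> ?I" "j \<in> ?I"
    then have mem: "p (g i) \<in> ?X" "g j \<in> ?X" using gI pX by simp_all
    then have "(right_translation G s \<circ> (inversion G \<circ> p)) (g i) = inv (p (g i)) \<otimes> s"
      using pX by (simp add: right_translation_def inversion_def extend_by_id_def)
    then show "(right_translation G s \<circ> (inversion G \<circ> p)) (g i) = g j \<longleftrightarrow> ?L i j = s"
      using inv_solve_left[of "g j" "p (g i)" s] mem s by auto
  qed
  have "row_parity ?X g ?L = (\<Sum>i\<in>?I. ?h (p (g i)))"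
    unfolding row_parity_def using row by simp
  also have "\<dots> = translation_parity_sum"
    unfolding reindex[of "\<lambda>a. ?h (p a)"] translation_parity_sum_def
    by (subst (2) sum.permute[OF p]) simp
  finally have "row_parity ?X g ?L = translation_parity_sum" .
  moreover have "col_parity ?X g ?L = (\<Sum>j\<in>?I. ?h (g j) + perm_parity p)"
    unfolding col_parity_def using col gI
    by (intro sum.cong)
       (simp_all add: perm_parity_comp[OF fin _ p] right_translation_permutes
         perm_parity_right_translation[OF fin])
  then have "col_parity ?X g ?L = translation_parity_sum + of_nat (order G) * perm_parity p"
    unfolding sum.distrib reindex[of ?h] translation_parity_sum_def order_def
    by (simp only: sum_constant card_atLeastAtMost diff_Suc_1)
  moreover have "symbol_parity ?X g ?L
      = (\<Sum>s\<in>?X. ?h s + (perm_parity (inversion G) + perm_parity p))"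
    unfolding symbol_parity_def
    by (intro sum.cong)
       (simp_all add: symbol perm_parity_comp[OF fin _ permutes_compose[OF p inversion_permutes]]
         perm_parity_comp[OF fin inversion_permutes p] right_translation_permutes
         perm_parity_right_translation[OF fin])
  then have "symbol_parity ?X g ?L = translation_parity_sum
      + of_nat (order G) * (perm_parity (inversion G) + perm_parity p)"
    unfolding sum.distrib[of ?h] translation_parity_sum_def order_def
    by (simp only: sum_constant)
  ultimately show ?thesis by (simp add: fhw_parity_type_def)
qed

lemma fhw_parity_type_even_order:
  assumes g: "enumerates g (carrier G)" and p: "p permutes carrier G" and even: "even (order G)"
  shows "fhw_parity_type (carrier G) g (\<lambda>i j. p (g i) \<otimes> g j) =
    (translation_parity_sum, translation_parity_sum, translation_parity_sum)"
proof -
  have "of_nat (order G) = (0 :: bit)" using even by (auto elim!: evenE)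
  then show ?thesis by (simp add: fhw_parity_type_left_perm[OF g p])
qed

lemma fhw_parity_type_odd_order:
  assumes g: "enumerates g (carrier G)" and p: "p permutes carrier G" and odd: "odd (order G)"
  shows "fhw_parity_type (carrier G) g (\<lambda>i j. p (g i) \<otimes> g j) =
    (0, perm_parity p, perm_parity p + of_nat (order G div 2))"
proof -
  have fin: "finite (carrier G)" using g by (simp add: enumerates_def)
  have "of_nat (order G) = (1 :: bit)" using odd by (auto elim!: oddE)
  moreover have "order G mod 4 \<noteq> 2" using odd by presburger
  ultimately show ?thesis
    using translation_parity_sum_eq_0[OF fin] perm_parity_inversion_odd_order[OF fin odd]
    by (simp add: fhw_parity_type_left_perm[OF g p] add.commute)
qed

section \<open>Complete mappings of the group of order three\<close>

text \<open>
  If \<open>y\<close> and \<open>z\<close> do not commute, then \<open>\<one>\<close>, \<open>y\<close> and \<open>z\<close> are distinct and exhaust the group. But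
  neither product of \<open>y\<close> and \<open>z\<close> can equal a factor, so both are \<open>\<one>\<close>.
\<close>

lemma order_3_commute:
  assumes order: "order G = 3" and y: "y \<in> carrier G" and z: "z \<in> carrier G"
  shows "y \<otimes> z = z \<otimes> y"
proof (rule ccontr)
  assume neq: "y \<otimes> z \<noteq> z \<otimes> y"
  have "y \<noteq> \<one>" "z \<noteq> \<one>" "y \<noteq> z" using neq y z by auto
  then have "card {\<one>, y, z} = card (carrier G)" using order by (simp add: order_def)
  moreover have "finite (carrier G)" using order by (simp add: order_def card_ge_0_finite)
  ultimately have "carrier G = {\<one>, y, z}"
    using y z by (intro card_subset_eq[symmetric]) auto
  moreover have "y \<otimes> z \<in> carrier G" "z \<otimes> y \<in> carrier G" using y z by simp_all
  moreover have "y \<otimes> z \<noteq> y" "y \<otimes> z \<noteq> z" "z \<otimes> y \<noteq> y" "z \<otimes> y \<noteq> z"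
    using y z \<open>y \<noteq> \<one>\<close> \<open>z \<noteq> \<one>\<close> by simp_all
  ultimately show False using neq by auto
qed

lemma order_3_carrier:
  assumes order: "order G = 3" and x: "x \<in> carrier G"
  obtains y z where "carrier G = {x, y, z}" "x \<noteq> y" "x \<noteq> z" "y \<noteq> z"
proof -
  have "finite (carrier G)" using order by (simp add: order_def card_ge_0_finite)
  then have "card (carrier G - {x}) = 2" using order x by (simp add: order_def)
  then obtain y z where "carrier G - {x} = {y, z}" "y \<noteq> z" by (auto simp: card_2_iff)
  with x that[of y z] show ?thesis by blast
qed

text \<open>
  Only a transposition of two points \<open>y\<close> and \<open>z\<close> could be odd. It is not a complete mapping,
  because \<open>y \<otimes> z = z \<otimes> y\<close>.
\<close>

lemma perm_parity_complete_mapping_order_3: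
  assumes order: "order G = 3" and f: "complete_mapping G f"
  shows "perm_parity f = 0"
proof (cases "\<exists>x\<in>carrier G. f x = x")
  case False
  then show ?thesis
    using f order by (intro perm_parity_three_no_fixed_point[of "carrier G"])
      (auto simp: complete_mapping_def order_def)
next
  case True
  then obtain x where x: "x \<in> carrier G" "f x = x" by blast
  obtain y z where X: "carrier G = {x, y, z}" and distinct: "x \<noteq> y" "x \<noteq> z" "y \<noteq> z"
    using order_3_carrier[OF order x(1)] by blast
  have "f \<noteq> transpose y z"
  proof
    assume "f = transpose y z"
    then have "tilde G f y = tilde G f z"
      using X order_3_commute[OF order, of y z] by (simp add: tilde_def)
    moreover have "inj (tilde G f)"
      using f unfolding complete_mapping_def by (blast intro: permutes_inj)
    ultimately show False using distinct by (simp add: inj_eq)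
  qed
  moreover have f_perm: "f permutes {x, y, z}" using f X by (simp add: complete_mapping_def)
  ultimately have "f = id"
    using permutes_three_fixed_point[OF f_perm x(2) distinct] by simp
  then show ?thesis by simp
qed

text \<open>
  The point that \<open>f\<close> sends to \<open>\<one>\<close> is fixed by \<open>tilde G f\<close>, and it is the only one, because \<open>f\<close> is
  injective. So \<open>tilde G f\<close> exchanges the other two points.
\<close>

lemma perm_parity_tilde_order_3:
  assumes order: "order G = 3" and f: "complete_mapping G f"
  shows "perm_parity (tilde G f) = 1"
proof -
  have fG: "f permutes carrier G" and t: "tilde G f permutes carrier G"
    using f by (simp_all add: complete_mapping_def)
  have "\<one> \<in> f ` carrier G" using permutes_image[OF fG] by simp
  then obtain x where x: "x \<in> carrier G" "f x = \<one>" by auto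
  then have fixed: "tilde G f x = x" by (simp add: tilde_def)
  obtain y z where X: "carrier G = {x, y, z}" and distinct: "x \<noteq> y" "x \<noteq> z" "y \<noteq> z"
    using order_3_carrier[OF order x(1)] by blast
  have "tilde G f \<noteq> id"
  proof
    assume "tilde G f = id"
    then have "tilde G f y = y" by simp
    moreover have y: "y \<in> carrier G" using X by simp
    moreover have fy: "f y \<in> carrier G" using y by (simp only: permutes_in_image[OF fG])
    ultimately have "y \<otimes> f y = y" by (simp add: tilde_def)
    with y fy have "f y = \<one>" by simp
    with x have "f y = f x" by simp
    with permutes_inj[OF fG] distinct show False by (simp add: inj_eq)
  qed
  then have "tilde G f = transpose y z"
    using permutes_three_fixed_point[OF t[unfolded X] fixed distinct] by simp
  with distinct show ?thesis by (simp add: perm_parity_def evenperm_swap)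
qed

end

section \<open>The parity types\<close>

theorem corollary5p2p8:
  fixes G :: "('a, 'b) monoid_scheme" and g :: "nat \<Rightarrow> 'a"
  assumes "group G" and "finite (carrier G)" and "enumerates g (carrier G)"
  defines "A \<equiv> cayley_table G g" and "B \<equiv> square_B G g" and "C \<equiv> square_C G g"
    and "pi_FHW \<equiv> fhw_parity_type (carrier G) g"
  shows
    "([order G = 0] (mod 4) \<longrightarrow>
        pi_FHW A = (0, 0, 0) \<and>
        (\<forall>f. complete_mapping G f \<longrightarrow>
          pi_FHW (B f) = (0, 0, 0) \<and> pi_FHW (C f) = (0, 0, 0))) \<and>
     (order G = 1 \<longrightarrow>
        pi_FHW A = (0, 0, 0) \<and>
        (\<forall>f. complete_mapping G f \<longrightarrow>
          pi_FHW (B f) = (0, 0, 0) \<and> pi_FHW (C f) = (0, 0, 0))) \<and>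
     (order G \<ge> 5 \<and> [order G = 1] (mod 4) \<longrightarrow>
        pi_FHW A = (0, 0, 0) \<and>
        (\<forall>f. complete_mapping G f \<longrightarrow>
          pi_FHW (B f) = (0, perm_parity (tilde G f), perm_parity (tilde G f)) \<and>
          pi_FHW (C f) = (0, perm_parity f, perm_parity f))) \<and>
     ([order G = 2] (mod 4) \<longrightarrow>
        pi_FHW A = (1, 1, 1) \<and> \<not> (\<exists>f. complete_mapping G f)) \<and>
     (order G = 3 \<longrightarrow>
        pi_FHW A = (0, 0, 1) \<and>
        (\<forall>f. complete_mapping G f \<longrightarrow>
          pi_FHW (B f) = (0, 1, 0) \<and> pi_FHW (C f) = (0, 0, 1))) \<and>
     (order G \<ge> 7 \<and> [order G = 3] (mod 4) \<longrightarrow>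
        pi_FHW A = (0, 0, 1) \<and>
        (\<forall>f. complete_mapping G f \<longrightarrow>
          pi_FHW (B f) = (0, perm_parity (tilde G f), perm_parity (tilde G f) + 1) \<and>
          pi_FHW (C f) = (0, perm_parity f, perm_parity f + 1)))"
proof -
  interpret group G by (rule assms(1))
  note fin = assms(2) and g = assms(3)
  let ?L = "\<lambda>p i j. p (g i) \<otimes>\<^bsub>G\<^esub> g j"
  have squares: "A = ?L id" "B f = ?L (tilde G f)" "C f = ?L f" for f
    by (simp_all add: A_def B_def C_def cayley_table_def square_B_def square_C_def fun_eq_iff)
  have perms: "f permutes carrier G" "tilde G f permutes carrier G"
    if "complete_mapping G f" for f
    using that by (simp_all add: complete_mapping_def)
  have zero: "pi_FHW (?L p) = (0, 0, 0)"
    if "p permutes carrier G" "order G mod 4 = 0" for p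
  proof -
    have "even (order G)" using that(2) by presburger
    with that show ?thesis
      by (simp add: pi_FHW_def fhw_parity_type_even_order[OF g] translation_parity_sum_eq_0[OF fin])
  qed
  have two: "pi_FHW (?L p) = (1, 1, 1)"
    if "p permutes carrier G" "order G mod 4 = 2" for p
  proof -
    have "even (order G)" using that(2) by presburger
    with that show ?thesis
      by (simp add: pi_FHW_def fhw_parity_type_even_order[OF g] translation_parity_sum_eq_1[OF fin])
  qed
  have one: "pi_FHW (?L p) = (0, perm_parity p, perm_parity p)"
    if "p permutes carrier G" "order G mod 4 = 1" for p
  proof -
    have "odd (order G)" "even (order G div 2)" using that(2) by presburger+
    with that show ?thesis
      by (auto simp: pi_FHW_def fhw_parity_type_odd_order[OF g] elim!: evenE)
  qed
  have three: "pi_FHW (?L p) = (0, perm_parity p, perm_parity p + 1)"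
    if "p permutes carrier G" "order G mod 4 = 3" for p
  proof -
    have "odd (order G)" "odd (order G div 2)" using that(2) by presburger+
    then have "of_nat (order G div 2) = (1 :: bit)" by (auto elim!: oddE)
    with that \<open>odd (order G)\<close> show ?thesis
      by (simp add: pi_FHW_def fhw_parity_type_odd_order[OF g])
  qed
  have trivial: "perm_parity p = 0" if "p permutes carrier G" "order G = 1" for p
  proof -
    obtain a where "carrier G = {a}"
      using \<open>order G = 1\<close> by (auto simp: order_def card_1_singleton_iff)
    with that have "p = id" by (simp add: permutes_sing)
    then show ?thesis by simp
  qed
  \<comment> \<open>The simplifier rewrites \<open>id (g i)\<close> in the square \<open>A\<close>, so the rules for \<open>A\<close> must be used in a
    form without \<open>id\<close>.\<close>
  note at_id = zero[OF permutes_id] one[OF permutes_id] two[OF permutes_id] three[OF permutes_id]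
  show ?thesis
    unfolding squares cong_def
  proof (intro conjI impI allI notI; (elim conjE exE)?)
    fix f assume "complete_mapping G f" "order G mod 4 = 2 mod 4"
    then show False using no_complete_mapping[OF fin, of f] by simp
  qed (use perms in \<open>simp_all add: at_id[unfolded perm_parity_id, unfolded id_apply] zero one two three trivial
      perm_parity_complete_mapping_order_3 perm_parity_tilde_order_3\<close>)
qed

end
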